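(* Let $G$ be a finite simple connected graph and let $xy\in E(G)$. If $G$ is upper-critical, then the graph $G/xy$ obtained by contracting the edge $xy$ is also upper-critical.
   Context: For two adjacent vertices $x,y$ of $G$, the edge contraction $G/xy$ is the simple graph obtained by replacing $x$ and $y$ by a single new vertex $z$ adjacent to exactly the vertices other than $x,y$ that lie in $N(x)\cup N(y)$, where $N(v)$ denotes the set of vertices adjacent to $v$. $\chi(G)$ is the chromatic number. $\overline{G}$ is the complement of $G$, and for $e\in E(\overline{G})$, $G+e$ is $G$ with the edge $e$ added. A graph $G$ is upper-critical if no edge can be added to it while preserving its chromatic number, i.e. $\{e\in E(\overline{G}) : \chi(G+e)=\chi(G)\}=\emptyset$ (equivalently, $\chi(G+e)>\chi(G)$ for all $e\in E(\overline{G})$; in particular every complete graph is upper-critical). *)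

theory Defs
  imports "Graph_Theory.Digraph_Component"
begin

text \<open>
  Finite simple graphs are the \<^locale>\<open>pair_graph\<close>s of \<open>Graph_Theory\<close>: finite, loop-free,
  symmetric digraphs without parallel arcs. An undirected edge \<open>uv\<close> is thus represented by the two
  arcs \<open>(u, v)\<close> and \<open>(v, u)\<close>.
\<close>

definition neighborhood :: "'a pair_pre_digraph \<Rightarrow> 'a \<Rightarrow> 'a set" where
  "neighborhood G v = {u. (v, u) \<in> parcs G}"

definition proper_coloring :: "'a pair_pre_digraph \<Rightarrow> nat \<Rightarrow> ('a \<Rightarrow> nat) \<Rightarrow> bool" where
  "proper_coloring G k c \<longleftrightarrow>
     (\<forall>v \<in> pverts G. c v < k) \<and> (\<forall>u v. (u, v) \<in> parcs G \<longrightarrow> c u \<noteq> c v)"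

text \<open>Only meaningful if some finite proper coloring exists, as in every finite loop-free graph.\<close>

definition chromatic_number :: "'a pair_pre_digraph \<Rightarrow> nat" where
  "chromatic_number G = (LEAST k. \<exists>c. proper_coloring G k c)"

definition complement :: "'a pair_pre_digraph \<Rightarrow> 'a pair_pre_digraph" where
  "complement G =
     \<lparr> pverts = pverts G,
       parcs = {(u, v). u \<in> pverts G \<and> v \<in> pverts G \<and> u \<noteq> v \<and> (u, v) \<notin> parcs G} \<rparr>"

definition add_edge :: "'a pair_pre_digraph \<Rightarrow> 'a \<times> 'a \<Rightarrow> 'a pair_pre_digraph" where
  "add_edge G e = \<lparr> pverts = pverts G, parcs = parcs G \<union> {e, prod.swap e} \<rparr>"

definition upper_critical :: "'a pair_pre_digraph \<Rightarrow> bool" where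
  "upper_critical G \<longleftrightarrow>
     {e \<in> parcs (complement G). chromatic_number (add_edge G e) = chromatic_number G} = {}"

text \<open>
  The new vertex is \<^const>\<open>None\<close>, which is automatically distinct from the surviving
  vertices \<open>Some v\<close>.
\<close>

definition contract_edge :: "'a pair_pre_digraph \<Rightarrow> 'a \<Rightarrow> 'a \<Rightarrow> 'a option pair_pre_digraph" where
  "contract_edge G x y =
     \<lparr> pverts = insert None (Some ` (pverts G - {x, y})),
       parcs =
         {(Some u, Some v) | u v. (u, v) \<in> parcs G \<and> u \<notin> {x, y} \<and> v \<notin> {x, y}} \<union>
         {(None, Some v) | v. v \<in> (neighborhood G x \<union> neighborhood G y) - {x, y}} \<union>
         {(Some v, None) | v. v \<in> (neighborhood G x \<union> neighborhood G y) - {x, y}} \<rparr>"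

lemma pair_graphI:
  assumes "finite (pverts G)" "parcs G \<subseteq> pverts G \<times> pverts G"
    and "irrefl (parcs G)" "sym (parcs G)"
  shows "pair_graph G"
proof
  show "finite (parcs G)"
    using assms(1,2) by (meson finite_SigmaI finite_subset)
  show "symmetric (with_proj G)"
    using assms(4) by (simp add: symmetric_def)
  show "fst e \<noteq> snd e" if "e \<in> parcs G" for e
    using that assms(3) by (cases e) (auto simp: irrefl_def)
qed (use assms(1,2) in auto)

lemma pair_graphD:
  assumes "pair_graph G"
  shows "finite (pverts G)" "(u, v) \<in> parcs G \<Longrightarrow> u \<in> pverts G"
    "(u, v) \<in> parcs G \<Longrightarrow> v \<in> pverts G" "(u, u) \<notin> parcs G"
    "(u, v) \<in> parcs G \<Longrightarrow> (v, u) \<in> parcs G"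
proof -
  interpret pair_graph G by fact
  show "finite (pverts G)" by (rule pair_finite_verts)
  show "u \<in> pverts G" "v \<in> pverts G" if "(u, v) \<in> parcs G"
    using that by (fact in_arcsD1, fact in_arcsD2)
  show "(u, u) \<notin> parcs G"
    using pair_no_loops by force
  show "(v, u) \<in> parcs G" if "(u, v) \<in> parcs G"
    using that pair_sym_arcs by (simp add: symmetric_def sym_def)
qed

lemma ex_proper_coloring:
  assumes "pair_graph G"
  shows "\<exists>k c. proper_coloring G k c"
proof -
  note G = pair_graphD[OF assms]
  obtain c :: "'a \<Rightarrow> nat" where c: "inj_on c (pverts G)"
    using finite_imp_inj_to_nat_seg[OF G(1)] by blast
  obtain k where k: "\<forall>n \<in> c ` pverts G. n < k"
    using G(1) finite_nat_set_iff_bounded[of "c ` pverts G"] by blast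
  have "c u \<noteq> c v" if "(u, v) \<in> parcs G" for u v
    using that G(2-4) c by (metis inj_onD)
  with k have "proper_coloring G k c"
    by (simp add: proper_coloring_def)
  then show ?thesis by blast
qed

lemma pair_graph_add_edge:
  assumes "pair_graph G" "e \<in> parcs (complement G)"
  shows "pair_graph (add_edge G e)"
  using assms(2) pair_graphD[OF assms(1)]
  by (intro pair_graphI) (auto simp: add_edge_def complement_def irrefl_def sym_def)

lemma pair_graph_contract_edge:
  assumes "pair_graph G"
  shows "pair_graph (contract_edge G x y)"
  using pair_graphD[OF assms]
  by (intro pair_graphI) (auto simp: contract_edge_def neighborhood_def irrefl_def sym_def)

end

theory Submission
  imports Defs
begin

text \<open>
  An upper-critical graph is the same thing as a complete multipartite graph. In one direction, fix
  an optimal coloring: an edge added between two color classes keeps the coloring proper, so all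
  such edges are already present, and the classes are the parts. Conversely, a proper coloring of a
  complete multipartite graph never uses a color in two parts. If an edge \<open>uv\<close> is added inside a
  part, then \<open>u\<close> and \<open>v\<close> receive two colors that occur in that part only, and merging them saves a
  color on the original graph; hence the added edge raises the chromatic number.

  Contraction of an edge \<open>xy\<close> visibly preserves complete multipartiteness: \<open>x\<close> and \<open>y\<close> lie in
  different parts, so every other vertex is adjacent to one of them, and the new vertex forms a part
  of its own, joined to the complete multipartite graph induced on the remaining vertices.
\<close>

text \<open>
  The parts are the fibres of \<open>c\<close> on the vertices. Since \<open>c\<close> may take values in any type, a graph
  and its contraction can use labels of different types.
\<close>

definition complete_multipartite_by :: "'a pair_pre_digraph \<Rightarrow> ('a \<Rightarrow> 'b) \<Rightarrow> bool" where
  "complete_multipartite_by G c \<longleftrightarrow>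
     parcs G = {(u, v). u \<in> pverts G \<and> v \<in> pverts G \<and> c u \<noteq> c v}"

lemma chromatic_number_le:
  "proper_coloring G k c \<Longrightarrow> chromatic_number G \<le> k"
  unfolding chromatic_number_def by (blast intro: Least_le)

lemma optimal_coloring:
  assumes "pair_graph G"
  obtains c where "proper_coloring G (chromatic_number G) c"
  using ex_proper_coloring[OF assms] LeastI_ex[of "\<lambda>k. \<exists>c. proper_coloring G k c"]
  unfolding chromatic_number_def by blast

text \<open>
  This frees colorings from using an initial segment of the naturals: only the number of colors that
  occur matters, so dropping a color needs no explicit renumbering.
\<close>

lemma chromatic_number_le_card_colors:
  assumes G: "pair_graph G"
    and c: "\<And>u v. (u, v) \<in> parcs G \<Longrightarrow> c u \<noteq> c v"
  shows "chromatic_number G \<le> card (c ` pverts G)"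
proof -
  have "finite (c ` pverts G)"
    using pair_graphD(1)[OF G] by blast
  then obtain h where h: "bij_betw h (c ` pverts G) {0..<card (c ` pverts G)}"
    using ex_bij_betw_finite_nat by blast
  have "h (c u) \<noteq> h (c v)" if "(u, v) \<in> parcs G" for u v
    using c[OF that] pair_graphD(2,3)[OF G that] bij_betw_imp_inj_on[OF h]
    by (simp add: inj_on_eq_iff)
  moreover have "h (c v) < card (c ` pverts G)" if "v \<in> pverts G" for v
    using bij_betwE[OF h] that by auto
  ultimately have "proper_coloring G (card (c ` pverts G)) (h \<circ> c)"
    by (simp add: proper_coloring_def)
  then show ?thesis
    by (rule chromatic_number_le)
qed

text \<open>
  Two nonadjacent vertices of different colors could be joined by an edge without spoiling the
  coloring, and adding edges never lowers the chromatic number. So every optimal coloring of an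
  upper-critical graph exhibits it as complete multipartite.
\<close>

lemma upper_critical_imp_complete_multipartite:
  assumes G: "pair_graph G" and crit: "upper_critical G"
    and c: "proper_coloring G (chromatic_number G) c"
  shows "complete_multipartite_by G c"
proof -
  have adjacent: "(u, v) \<in> parcs G"
    if uv: "u \<in> pverts G" "v \<in> pverts G" "c u \<noteq> c v" for u v
  proof (rule ccontr)
    assume "(u, v) \<notin> parcs G"
    with uv have e: "(u, v) \<in> parcs (complement G)"
      by (auto simp: complement_def)
    have "proper_coloring (add_edge G (u, v)) (chromatic_number G) c"
      using c uv(3) by (auto simp: proper_coloring_def add_edge_def)
    then have "chromatic_number (add_edge G (u, v)) \<le> chromatic_number G"
      by (rule chromatic_number_le)
    moreover obtain d where
      "proper_coloring (add_edge G (u, v)) (chromatic_number (add_edge G (u, v))) d"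
      using optimal_coloring[OF pair_graph_add_edge[OF G e]] .
    then have "proper_coloring G (chromatic_number (add_edge G (u, v))) d"
      by (auto simp: proper_coloring_def add_edge_def)
    then have "chromatic_number G \<le> chromatic_number (add_edge G (u, v))"
      by (rule chromatic_number_le)
    ultimately show False
      using crit e by (auto simp: upper_critical_def)
  qed
  have "c u \<noteq> c v" if "(u, v) \<in> parcs G" for u v
    using c that by (simp add: proper_coloring_def)
  then show ?thesis
    unfolding complete_multipartite_by_def
    using adjacent pair_graphD(2,3)[OF G] by blast
qed

text \<open>
  If \<open>G\<close> plus an edge \<open>uv\<close> inside a part had an optimal coloring \<open>d\<close> with only
  \<open>chromatic_number G\<close> colors, then recoloring every vertex of color \<open>d v\<close> by \<open>d u\<close> would give a
  proper coloring of \<open>G\<close> that avoids the color \<open>d v\<close>.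
\<close>

lemma complete_multipartite_imp_upper_critical:
  assumes G: "pair_graph G" and mult: "complete_multipartite_by G c"
  shows "upper_critical G"
proof -
  have False
    if e: "(u, v) \<in> parcs (complement G)"
      and eq: "chromatic_number (add_edge G (u, v)) = chromatic_number G" for u v
  proof -
    from e mult have uv: "u \<in> pverts G" "v \<in> pverts G" "c u = c v"
      by (auto simp: complement_def complete_multipartite_by_def)
    obtain d where d: "proper_coloring (add_edge G (u, v)) (chromatic_number G) d"
      using optimal_coloring[OF pair_graph_add_edge[OF G e]] eq by metis
    then have d_uv: "d u \<noteq> d v"
      and d_lt: "\<And>w. w \<in> pverts G \<Longrightarrow> d w < chromatic_number G"
      and d_arc: "\<And>a b. (a, b) \<in> parcs G \<Longrightarrow> d a \<noteq> d b"
      by (auto simp: proper_coloring_def add_edge_def)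
    have part: "c a = c b" if "a \<in> pverts G" "b \<in> pverts G" "d a = d b" for a b
      using that d_arc mult by (auto simp: complete_multipartite_by_def)
    define d' where "d' w = (if d w = d v then d u else d w)" for w
    have "d' a \<noteq> d' b" if ab: "(a, b) \<in> parcs G" for a b
    proof -
      have V: "a \<in> pverts G" "b \<in> pverts G" and parts: "c a \<noteq> c b"
        using ab mult by (auto simp: complete_multipartite_by_def)
      (* Colors d u and d v occur only in the part of u and v, which cannot contain both a and b. *)
      then show ?thesis
        using d_arc[OF ab] part[OF V(1) uv(1)] part[OF V(2) uv(1)]
          part[OF V(1) uv(2)] part[OF V(2) uv(2)] uv(3)
        unfolding d'_def by metis
    qed
    then have "chromatic_number G \<le> card (d' ` pverts G)"
      by (rule chromatic_number_le_card_colors[OF G])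
    also have "\<dots> \<le> card ({..<chromatic_number G} - {d v})"
      using d_lt uv d_uv by (intro card_mono) (auto simp: d'_def)
    also have "\<dots> < chromatic_number G"
      using d_lt[OF uv(2)] by simp
    finally show False by simp
  qed
  then show ?thesis
    by (auto simp: upper_critical_def)
qed

text \<open>
  With the labels \<open>map_option c\<close>, surviving vertices keep their part, while the new vertex
  \<^const>\<open>None\<close> is alone in its part.
\<close>

lemma complete_multipartite_contract_edge:
  assumes "complete_multipartite_by G c" and xy: "(x, y) \<in> parcs G"
  shows "complete_multipartite_by (contract_edge G x y) (map_option c)"
proof -
  have arcs: "parcs G = {(u, v). u \<in> pverts G \<and> v \<in> pverts G \<and> c u \<noteq> c v}"
    using assms(1) by (simp add: complete_multipartite_by_def)
  (* A vertex adjacent to neither x nor y would share the part of both. *)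
  have nb: "(neighborhood G x \<union> neighborhood G y) - {x, y} = pverts G - {x, y}"
    using xy by (auto simp: neighborhood_def arcs)
  have "(p, q) \<in> parcs (contract_edge G x y) \<longleftrightarrow>
      p \<in> pverts (contract_edge G x y) \<and> q \<in> pverts (contract_edge G x y) \<and>
      map_option c p \<noteq> map_option c q" for p q
    unfolding contract_edge_def nb by (cases p; cases q) (auto simp: arcs)
  then show ?thesis
    unfolding complete_multipartite_by_def by (simp add: set_eq_iff split_paired_all)
qed

theorem theorem8:
  fixes G :: "'a pair_pre_digraph" and x y :: 'a
  assumes "pair_graph G"
    and "Digraph_Component.connected (with_proj G)"
    and "(x, y) \<in> parcs G"
    and "upper_critical G"
  shows "upper_critical (contract_edge G x y)"
proof -
  obtain c where "proper_coloring G (chromatic_number G) c"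
    using optimal_coloring[OF assms(1)] .
  then have "complete_multipartite_by G c"
    by (rule upper_critical_imp_complete_multipartite[OF assms(1,4)])
  then have "complete_multipartite_by (contract_edge G x y) (map_option c)"
    using assms(3) by (rule complete_multipartite_contract_edge)
  then show ?thesis
    by (rule complete_multipartite_imp_upper_critical[OF pair_graph_contract_edge[OF assms(1)]])
qed

end
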